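(* Let $f\in L^2(\mathbb{R}^d)$ have the form $$f(x)=\sum_{i=1}^{\infty} a_i\,\phi(x;B_i,C_i)+u(x),$$ where each $\phi(\cdot;B_i,C_i)$ is an $L^2$-normalized Gaussian on $\mathbb{R}^d$ ($\|\phi(\cdot;B_i,C_i)\|=1$), the real coefficients satisfy $\sum_{i}|a_i|=K<\infty$, and $u\in L^2(\mathbb{R}^d)$ satisfies $\|u\|\le\varepsilon$. For each $i$ let $\phi_i=s_iK\phi(\cdot;B_i,C_i)$, where $s_i\in\{+1,-1\}$ and $s_i|a_i|=a_i$. Let $(f_n)_{n\ge 0}$ be a sequence of functions in $L^2(\mathbb{R}^d)$ produced by the relaxed greedy recursion: for each $n\ge 0$, $f_{n+1}=(1-\lambda)f_n+\lambda\varphi$, where $(\lambda,\varphi)$ solves $$\inf_{\lambda\in[0,1],\ \varphi\in\{\phi_i : i\ge 1\}}\ \left\|(1-\lambda)f_n+\lambda\varphi-f\right\|^2 .$$ Then for each $\alpha\in(0,1)$ and each $n\ge 1$, $$\varepsilon_n^2:=\|f_n-f\|^2\le\max\left\{\frac{[(K+1)/\alpha]^2}{n},\ \frac{\varepsilon^2}{(1-\alpha)^2}\right\}.$$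
   Context: $\|\cdot\|$ denotes the norm of the real Hilbert space $L^2(\mathbb{R}^d)$, and $\varepsilon\ge 0$ is a real number. $\phi(x;B,C)$ denotes a multidimensional Gaussian function of $x\in\mathbb{R}^d$ with precision matrix $B$ (the inverse of the covariance matrix, symmetric positive definite) and center $C\in\mathbb{R}^d$, i.e. a positive multiple of $\exp(-\tfrac12 (x-C)^{T}B(x-C))$, scaled so that $\|\phi(\cdot;B,C)\|=1$. The series $\sum_i a_i\phi(\cdot;B_i,C_i)$ converges in $L^2$ since $\sum_i|a_i|<\infty$. With the functions $\phi_i$ defined in the claim, $f-u$ is a (countably infinite) convex combination of the $\phi_i$ (with weights $|a_i|/K$ when $K>0$). The initial approximation $f_0\in L^2(\mathbb{R}^d)$ is arbitrary. At each step a minimizer $(\lambda,\varphi)$ is assumed to exist and $f_{n+1}$ is defined by any such minimizer. *)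

theory Defs
  imports "HOL-Analysis.Analysis" "HOL-Probability.Distributions"
begin

text \<open>
  Elements of the real Hilbert space \<open>L\<^sup>2\<close> are represented by square-integrable functions; two
  functions that agree almost everywhere represent the same element.
\<close>

definition L2 :: "('a::euclidean_space \<Rightarrow> real) set" where
  "L2 = {f. f \<in> borel_measurable lebesgue \<and> integrable lebesgue (\<lambda>x. (f x)\<^sup>2)}"

text \<open>
  Because the Bochner integral of a non-integrable function is 0, this is the \<open>L\<^sup>2\<close> norm only for
  functions in \<^const>\<open>L2\<close>.
\<close>

definition L2norm :: "('a::euclidean_space \<Rightarrow> real) \<Rightarrow> real" where
  "L2norm f = sqrt (LINT x|lebesgue. (f x)\<^sup>2)"

definition L2_sums :: "(nat \<Rightarrow> 'a::euclidean_space \<Rightarrow> real) \<Rightarrow> ('a \<Rightarrow> real) \<Rightarrow> bool" where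
  "L2_sums g h \<longleftrightarrow> (\<lambda>N. L2norm (\<lambda>x. (\<Sum>i<N. g i x) - h x)) \<longlonglongrightarrow> 0"

definition sym_pos_def :: "real^'d^'d \<Rightarrow> bool" where
  "sym_pos_def B \<longleftrightarrow> transpose B = B \<and> (\<forall>x. x \<noteq> 0 \<longrightarrow> 0 < x \<bullet> (B *v x))"

definition gauss_profile :: "real^'d^'d \<Rightarrow> real^'d \<Rightarrow> real^'d \<Rightarrow> real" where
  "gauss_profile B C x = exp (- (1/2) * ((x - C) \<bullet> (B *v (x - C))))"

definition gauss :: "real^'d^'d \<Rightarrow> real^'d \<Rightarrow> real^'d \<Rightarrow> real" where
  "gauss B C x = gauss_profile B C x / L2norm (gauss_profile B C)"

lemma sym_pos_def_bound:
  assumes "sym_pos_def (B::real^'d^'d)"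
  obtains c where "0 < c" "\<And>x. c * (norm x)\<^sup>2 \<le> x \<bullet> (B *v x)"
proof -
  have "continuous_on (sphere 0 1) (\<lambda>x::real^'d. x \<bullet> (B *v x))"
    by (intro continuous_intros matrix_vector_mult_linear_continuous_on)
  then obtain m where m: "m \<in> sphere (0::real^'d) 1"
    "\<And>y. y \<in> sphere 0 1 \<Longrightarrow> m \<bullet> (B *v m) \<le> y \<bullet> (B *v y)"
    using continuous_attains_inf[of "sphere (0::real^'d) 1" "\<lambda>x. x \<bullet> (B *v x)"] by auto
  have "m \<noteq> 0" using m(1) by auto
  then have "0 < m \<bullet> (B *v m)"
    using assms by (simp add: sym_pos_def_def)
  moreover have "(m \<bullet> (B *v m)) * (norm x)\<^sup>2 \<le> x \<bullet> (B *v x)" for x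
  proof (cases "x = 0")
    case False
    define y where "y = x /\<^sub>R norm x"
    have x: "x = norm x *\<^sub>R y" and "y \<in> sphere 0 1"
      using False by (auto simp: y_def)
    then have "(norm x)\<^sup>2 * (m \<bullet> (B *v m)) \<le> (norm x)\<^sup>2 * (y \<bullet> (B *v y))"
      by (intro mult_left_mono m) auto
    also have "\<dots> = (norm x *\<^sub>R y) \<bullet> (B *v (norm x *\<^sub>R y))"
      by (simp add: matrix_vector_mult_scaleR power2_eq_square)
    also have "\<dots> = x \<bullet> (B *v x)" using x by simp
    finally show ?thesis by (simp add: mult.commute)
  qed simp
  ultimately show ?thesis using that by blast
qed

lemma integrable_exp_neg_norm_sq:
  assumes "0 < c"
  shows "integrable lborel (\<lambda>x::'a::euclidean_space. exp (- (c * (norm (x - z))\<^sup>2)))"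
proof -
  have 1: "(\<integral>\<^sup>+x. ennreal (exp (- (c * (x - m)\<^sup>2))) \<partial>lborel) < \<infinity>" for m :: real
  proof -
    define \<sigma> where "\<sigma> = sqrt (1 / (2 * c))"
    have \<sigma>: "0 < \<sigma>" "\<sigma>\<^sup>2 = 1 / (2 * c)" using assms by (auto simp: \<sigma>_def)
    have "integrable lborel (\<lambda>x. sqrt (2 * pi * \<sigma>\<^sup>2) * normal_density m \<sigma> x)"
      using \<sigma> by (intro integrable_mult_right) simp
    also have "(\<lambda>x. sqrt (2 * pi * \<sigma>\<^sup>2) * normal_density m \<sigma> x) = (\<lambda>x. exp (- (c * (x - m)\<^sup>2)))"
      using \<sigma>(1) unfolding normal_density_def using assms by (simp add: \<sigma>(2) field_simps)
    finally show ?thesis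
      by (subst (asm) integrable_iff_bounded) simp
  qed
  have eq: "exp (- (c * (norm (x - z))\<^sup>2)) = (\<Prod>b\<in>Basis. exp (- (c * (x \<bullet> b - z \<bullet> b)\<^sup>2)))" for x :: 'a
  proof -
    have "(norm (x - z))\<^sup>2 = (\<Sum>b\<in>Basis. (x \<bullet> b - z \<bullet> b)\<^sup>2)"
      unfolding power2_norm_eq_inner
      by (subst euclidean_inner) (simp only: inner_diff_left power2_eq_square)
    then show ?thesis by (simp add: exp_sum[symmetric] sum_distrib_left sum_negf)
  qed
  have "(\<integral>\<^sup>+x. ennreal (exp (- (c * (norm (x - z))\<^sup>2))) \<partial>(lborel::'a measure)) =
        (\<integral>\<^sup>+x. (\<Prod>b\<in>Basis. ennreal (exp (- (c * (x \<bullet> b - z \<bullet> b)\<^sup>2)))) \<partial>lborel)"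
    by (simp add: eq prod_ennreal)
  also have "\<dots> = (\<Prod>b\<in>Basis. (\<integral>\<^sup>+x. ennreal (exp (- (c * (x - z \<bullet> b)\<^sup>2))) \<partial>lborel))"
    by (rule nn_integral_lborel_prod) auto
  also have "\<dots> < \<infinity>"
    using 1 by (simp add: ennreal_prod_eq_top less_top[symmetric])
  finally show ?thesis by (subst integrable_iff_bounded) simp
qed

lemma gauss_profile_measurable: "gauss_profile B C \<in> borel_measurable borel"
proof -
  have "continuous_on UNIV (gauss_profile B C)"
    unfolding gauss_profile_def
    by (intro continuous_intros matrix_vector_mult_linear_continuous_on
          continuous_on_compose2[OF matrix_vector_mult_linear_continuous_on[of UNIV B]]) auto
  then show ?thesis by (rule borel_measurable_continuous_onI)
qed

lemma gauss_profile_L2: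
  assumes "sym_pos_def B"
  shows "gauss_profile B C \<in> L2"
proof -
  note [measurable] = gauss_profile_measurable[of B C]
  obtain c where c: "0 < c" "\<And>x. c * (norm x)\<^sup>2 \<le> x \<bullet> (B *v x)"
    using sym_pos_def_bound[OF assms] by blast
  have sq: "(gauss_profile B C x)\<^sup>2 = exp (- ((x - C) \<bullet> (B *v (x - C))))" for x
    by (simp add: gauss_profile_def exp_double[symmetric])
  have "integrable lborel (\<lambda>x. (gauss_profile B C x)\<^sup>2)"
    by (rule Bochner_Integration.integrable_bound[OF integrable_exp_neg_norm_sq[OF c(1), of C]])
      (use c(2) in \<open>auto simp: sq[symmetric] intro!: AE_I2\<close>, auto simp: sq)
  then show ?thesis
    by (simp add: L2_def integrable_completion measurable_completion)
qed

lemma L2norm_gauss_profile_pos: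
  assumes "sym_pos_def B"
  shows "0 < L2norm (gauss_profile B C)"
proof -
  have int: "integrable lebesgue (\<lambda>x. (gauss_profile B C x)\<^sup>2)"
    using gauss_profile_L2[OF assms] by (simp add: L2_def)
  have pos: "gauss_profile B C x \<noteq> 0" for x by (simp add: gauss_profile_def)
  have "(LINT x|lebesgue. (gauss_profile B C x)\<^sup>2) \<noteq> 0"
  proof
    assume "(LINT x|lebesgue. (gauss_profile B C x)\<^sup>2) = 0"
    then have "AE x in lebesgue. (gauss_profile B C x)\<^sup>2 = 0"
      using integral_nonneg_eq_0_iff_AE[OF int] by simp
    then have "AE x::real^'a in lebesgue. False" using pos by simp
    then show False by (simp add: ae_filter_eq_bot_iff eventually_False)
  qed
  then show ?thesis
    by (simp add: L2norm_def order_less_le)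
qed

lemma gauss_normalized:
  assumes "sym_pos_def B"
  shows "gauss B C \<in> L2" "L2norm (gauss B C) = 1"
proof -
  let ?N = "L2norm (gauss_profile B C)"
  note N = L2norm_gauss_profile_pos[OF assms, of C]
  have eq: "gauss B C = (\<lambda>x. gauss_profile B C x / ?N)" by (simp add: gauss_def fun_eq_iff)
  show "gauss B C \<in> L2"
    using gauss_profile_L2[OF assms, of C] by (auto simp: L2_def eq power_divide)
  have "(LINT x|lebesgue. (gauss_profile B C x)\<^sup>2) = ?N\<^sup>2"
    by (simp add: L2norm_def)
  then have "(LINT x|lebesgue. (gauss B C x)\<^sup>2) = ?N\<^sup>2 / ?N\<^sup>2"
    by (simp only: gauss_def power_divide integral_divide_zero)
  also have "\<dots> = 1"
    using N by simp
  finally show "L2norm (gauss B C) = 1"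
    by (simp only: L2norm_def real_sqrt_one)
qed

definition relaxed_greedy_step ::
  "('a::euclidean_space \<Rightarrow> real) set \<Rightarrow> ('a \<Rightarrow> real) \<Rightarrow> ('a \<Rightarrow> real) \<Rightarrow> ('a \<Rightarrow> real) \<Rightarrow> bool" where
  "relaxed_greedy_step D f g g' \<longleftrightarrow>
     (\<exists>l \<phi>. is_arg_min (\<lambda>(l, \<phi>). (L2norm (\<lambda>x. (1 - l) * g x + l * \<phi> x - f x))\<^sup>2)
               (\<lambda>p. p \<in> {0..1} \<times> D) (l, \<phi>) \<and>
            (AE x in lebesgue. g' x = (1 - l) * g x + l * \<phi> x))"

end

theory Submission
  imports Defs
begin

text \<open>
  Write \<open>e\<^sub>k = \<parallel>F k - f\<parallel>\<close> and \<open>h = f - u\<close>. The proof rests on averaging over the dictionary: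
  \<open>h\<close> is a convex combination \<open>\<Sum>\<^sub>i w\<^sub>i \<phi>\<^sub>i\<close> of elements of norm \<open>K\<close>. A minimizer does at least as well as
  every single \<open>\<phi>\<^sub>i\<close>, hence at least as well as the \<open>w\<close>-average of the \<open>\<phi>\<^sub>i\<close>. Expanding the square,
  the average of \<open>\<parallel>r + \<lambda>\<phi>\<^sub>i\<parallel>\<^sup>2\<close> exceeds \<open>\<parallel>r + \<lambda>h\<parallel>\<^sup>2\<close> only by \<open>\<lambda>\<^sup>2\<close> times the variance
  \<open>\<Sum>\<^sub>i w\<^sub>i \<parallel>\<phi>\<^sub>i\<parallel>\<^sup>2 - \<parallel>h\<parallel>\<^sup>2 \<le> K\<^sup>2\<close> (\<open>convex_average_bound\<close>). With \<open>r = (1 - \<lambda>) F k - f\<close> one has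
  \<open>r + \<lambda>h = (1 - \<lambda>)(F k - f) - \<lambda>u\<close>, so for every \<open>\<lambda> \<in> [0, 1]\<close>
  \<open>e\<^bsub>k+1\<^esub>\<^sup>2 \<le> ((1 - \<lambda>) e\<^sub>k + \<lambda>\<epsilon>)\<^sup>2 + \<lambda>\<^sup>2K\<^sup>2\<close> (\<open>relaxed_greedy_step_bound\<close>).

  What remains concerns real sequences (\<open>relaxed_recursion_bound\<close>). The choice \<open>\<lambda> = 0\<close> shows that
  \<open>e\<close> is nonincreasing, so nothing is to be done once \<open>e\<^sub>k \<le> \<epsilon>/(1 - \<alpha>)\<close>. Before that,
  \<open>\<epsilon> < (1 - \<alpha>) e\<^sub>k\<close> turns the inequality into
  \<open>e\<^bsub>k+1\<^esub>\<^sup>2 \<le> (1 - \<alpha>\<lambda>)\<^sup>2 e\<^sub>k\<^sup>2 + (\<alpha>\<lambda>)\<^sup>2 (K/\<alpha>)\<^sup>2\<close>. Its minimum over \<open>\<lambda>\<close> gives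
  \<open>1/e\<^bsub>k+1\<^esub>\<^sup>2 \<ge> 1/e\<^sub>k\<^sup>2 + \<alpha>\<^sup>2/K\<^sup>2\<close>, that is, \<open>e\<^sub>n\<^sup>2 \<le> (K/\<alpha>)\<^sup>2/n\<close>. The minimizing \<open>\<lambda>\<close> is at most \<open>1\<close> because the
  previous step with \<open>\<lambda> = 1\<close> gave \<open>e\<^sub>k\<^sup>2 \<le> K\<^sup>2 + \<epsilon>\<^sup>2\<close>. The bound with \<open>(K + 1)/\<alpha>\<close> follows
  since \<open>0 \<le> K\<close>.
\<close>

section \<open>The inner product of square-integrable functions\<close>

definition L2inner :: "('a::euclidean_space \<Rightarrow> real) \<Rightarrow> ('a \<Rightarrow> real) \<Rightarrow> real" where
  "L2inner f g = (LINT x|lebesgue. f x * g x)"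

lemma L2_mult_integrable:
  assumes "f \<in> L2" "g \<in> L2"
  shows "integrable lebesgue (\<lambda>x. f x * g x)"
proof (rule Bochner_Integration.integrable_bound)
  show "integrable lebesgue (\<lambda>x. (f x)\<^sup>2 + (g x)\<^sup>2)"
    using assms by (auto simp: L2_def)
  show "(\<lambda>x. f x * g x) \<in> borel_measurable lebesgue"
    using assms by (auto simp: L2_def)
  have "\<bar>a * b\<bar> \<le> a\<^sup>2 + b\<^sup>2" for a b :: real
    using sum_squares_bound[of "\<bar>a\<bar>" "\<bar>b\<bar>"] mult_nonneg_nonneg[OF abs_ge_zero[of a] abs_ge_zero[of b]]
    unfolding abs_mult power2_abs by linarith
  then show "AE x in lebesgue. norm (f x * g x) \<le> norm ((f x)\<^sup>2 + (g x)\<^sup>2)"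
    by (simp flip: abs_mult)
qed

lemma L2_cmult: "f \<in> L2 \<Longrightarrow> (\<lambda>x. c * f x) \<in> L2"
  by (auto simp: L2_def power_mult_distrib)

lemma L2_add:
  assumes "f \<in> L2" "g \<in> L2"
  shows "(\<lambda>x. f x + g x) \<in> L2"
  using assms L2_mult_integrable[OF assms]
  by (auto simp: L2_def power2_sum mult.assoc)

lemma L2_diff:
  assumes "f \<in> L2" "g \<in> L2"
  shows "(\<lambda>x. f x - g x) \<in> L2"
  using L2_add[OF assms(1) L2_cmult[OF assms(2), of "-1"]] by simp

lemma L2_sum: "(\<And>i. g i \<in> L2) \<Longrightarrow> (\<lambda>x. \<Sum>i<N::nat. g i x) \<in> L2"
proof (induction N)
  case 0
  then show ?case by (simp add: L2_def)
next
  case (Suc N)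
  then show ?case by (auto intro: L2_add)
qed

lemma L2norm_nonneg: "0 \<le> L2norm f"
  by (simp add: L2norm_def)

lemma L2norm_sq: "(L2norm f)\<^sup>2 = L2inner f f"
  by (simp add: L2norm_def L2inner_def power2_eq_square)

lemma L2inner_cmult_right: "L2inner f (\<lambda>x. c * g x) = c * L2inner f g"
  by (simp add: L2inner_def mult.left_commute)

lemma L2norm_cmult: "L2norm (\<lambda>x. c * f x) = \<bar>c\<bar> * L2norm f"
  by (simp add: L2norm_def power_mult_distrib real_sqrt_mult)

lemma L2inner_diff_right:
  assumes "f \<in> L2" "g \<in> L2" "h \<in> L2"
  shows "L2inner f (\<lambda>x. g x - h x) = L2inner f g - L2inner f h"
  using assms by (simp add: L2inner_def right_diff_distrib L2_mult_integrable)

lemma L2inner_sum_right: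
  assumes "f \<in> L2" "\<And>i. g i \<in> L2"
  shows "L2inner f (\<lambda>x. \<Sum>i<N::nat. g i x) = (\<Sum>i<N. L2inner f (g i))"
  using assms by (simp add: L2inner_def sum_distrib_left L2_mult_integrable)

lemma L2norm_sq_add_cmult:
  assumes "f \<in> L2" "g \<in> L2"
  shows "(L2norm (\<lambda>x. f x + t * g x))\<^sup>2 = (L2norm f)\<^sup>2 + 2 * t * L2inner f g + t\<^sup>2 * (L2norm g)\<^sup>2"
proof -
  note int = L2_mult_integrable[OF assms] L2_mult_integrable[OF assms(1) assms(1)]
    L2_mult_integrable[OF assms(2) assms(2)]
  have "(L2norm (\<lambda>x. f x + t * g x))\<^sup>2
      = (LINT x|lebesgue. f x * f x + 2 * t * (f x * g x) + t\<^sup>2 * (g x * g x))"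
    unfolding L2norm_sq L2inner_def
    by (rule Bochner_Integration.integral_cong) (auto simp: algebra_simps power2_eq_square)
  also have "\<dots> = (L2norm f)\<^sup>2 + 2 * t * L2inner f g + t\<^sup>2 * (L2norm g)\<^sup>2"
    using int by (simp add: L2norm_sq L2inner_def)
  finally show ?thesis .
qed

lemma L2_Cauchy_Schwarz:
  assumes "f \<in> L2" "g \<in> L2"
  shows "\<bar>L2inner f g\<bar> \<le> L2norm f * L2norm g"
proof -
  let ?A = "(L2norm f)\<^sup>2" and ?p = "L2inner f g" and ?B = "(L2norm g)\<^sup>2"
  have nn: "0 \<le> ?A + 2 * t * ?p + t\<^sup>2 * ?B" for t
    using L2norm_sq_add_cmult[OF assms, of t] by (metis zero_le_power2)
  have "?p\<^sup>2 \<le> ?A * ?B"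
  proof (cases "?B = 0")
    case True
    \<comment> \<open>The quadratic degenerates to an affine function of \<open>t\<close>, which can only be bounded below if
      its slope vanishes; this \<open>t\<close> would make its value \<open>-1\<close>.\<close>
    have "?p = 0"
    proof (rule ccontr)
      assume "?p \<noteq> 0"
      then have "2 * (- (?A + 1) / (2 * ?p)) * ?p = - (?A + 1)" by simp
      then show False using nn[of "- (?A + 1) / (2 * ?p)"] unfolding True by linarith
    qed
    then show ?thesis by simp
  next
    case False
    then have "0 < ?B" by simp
    \<comment> \<open>The minimum of the quadratic.\<close>
    have "?A + 2 * (- ?p / ?B) * ?p + (- ?p / ?B)\<^sup>2 * ?B = ?A - ?p\<^sup>2 / ?B"
      using \<open>0 < ?B\<close> by (simp add: field_simps power2_eq_square)
    then have "0 \<le> ?A - ?p\<^sup>2 / ?B"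
      using nn[of "- ?p / ?B"] by linarith
    then show ?thesis
      using \<open>0 < ?B\<close> by (simp add: field_simps)
  qed
  then have "\<bar>?p\<bar>\<^sup>2 \<le> (L2norm f * L2norm g)\<^sup>2"
    by (simp add: power_mult_distrib)
  then show ?thesis
    by (rule power2_le_imp_le) (simp add: L2norm_nonneg)
qed

lemma L2norm_triangle:
  assumes "f \<in> L2" "g \<in> L2"
  shows "L2norm (\<lambda>x. f x + g x) \<le> L2norm f + L2norm g"
proof (rule power2_le_imp_le)
  have "(L2norm (\<lambda>x. f x + g x))\<^sup>2 = (L2norm f)\<^sup>2 + 2 * L2inner f g + (L2norm g)\<^sup>2"
    using L2norm_sq_add_cmult[OF assms, of 1] by simp
  also have "\<dots> \<le> (L2norm f + L2norm g)\<^sup>2"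
    using L2_Cauchy_Schwarz[OF assms] by (simp add: power2_sum)
  finally show "(L2norm (\<lambda>x. f x + g x))\<^sup>2 \<le> (L2norm f + L2norm g)\<^sup>2" .
qed (simp add: L2norm_nonneg)

lemma L2norm_cong_AE:
  assumes "f \<in> L2" "g \<in> L2" "AE x in lebesgue. f x = g x"
  shows "L2norm f = L2norm g"
proof -
  have "(LINT x|lebesgue. (f x)\<^sup>2) = (LINT x|lebesgue. (g x)\<^sup>2)"
    using assms by (intro integral_cong_AE) (auto simp: L2_def)
  then show ?thesis by (simp add: L2norm_def)
qed

text \<open>
  Termwise integration: by the Cauchy--Schwarz inequality, taking the inner product with a fixed
  element is continuous.
\<close>

lemma L2_sums_L2inner:
  assumes "f \<in> L2" "\<And>i. g i \<in> L2" "h \<in> L2" "L2_sums g h"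
  shows "(\<lambda>i. L2inner f (g i)) sums L2inner f h"
proof -
  have bd: "\<bar>(\<Sum>i<N. L2inner f (g i)) - L2inner f h\<bar> \<le> L2norm f * L2norm (\<lambda>x. (\<Sum>i<N. g i x) - h x)"
    for N
  proof -
    have "(\<Sum>i<N. L2inner f (g i)) - L2inner f h = L2inner f (\<lambda>x. (\<Sum>i<N. g i x) - h x)"
      using assms by (simp add: L2inner_diff_right L2inner_sum_right L2_sum)
    then show ?thesis
      using assms by (simp add: L2_Cauchy_Schwarz L2_diff L2_sum)
  qed
  have "(\<lambda>N. L2norm f * L2norm (\<lambda>x. (\<Sum>i<N. g i x) - h x)) \<longlonglongrightarrow> 0"
    using assms(4) by (auto simp: L2_sums_def intro: tendsto_mult_right_zero)
  then have "(\<lambda>N. (\<Sum>i<N. L2inner f (g i)) - L2inner f h) \<longlonglongrightarrow> 0"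
    by (rule Lim_null_comparison[rotated]) (simp add: bd)
  then show ?thesis
    by (simp add: sums_def LIM_zero_iff)
qed

section \<open>Averaging over the dictionary\<close>

text \<open>
  A number below every \<open>\<parallel>r + l\<phi>\<^sub>i\<parallel>\<^sup>2\<close> is below their average
  \<open>\<parallel>r\<parallel>\<^sup>2 + 2l\<langle>r, h\<rangle> + l\<^sup>2 \<Sum>\<^sub>i w\<^sub>i \<parallel>\<phi>\<^sub>i\<parallel>\<^sup>2\<close>, which is \<open>\<parallel>r + lh\<parallel>\<^sup>2\<close> plus \<open>l\<^sup>2\<close> times the variance of the
  family. Dropping \<open>- l\<^sup>2\<parallel>h\<parallel>\<^sup>2\<close> from the variance gives the bound.
\<close>

lemma convex_average_bound:
  assumes r: "r \<in> L2" and h: "h \<in> L2" and \<phi>: "\<And>i. \<phi> i \<in> L2" "\<And>i. L2norm (\<phi> i) \<le> K"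
    and w: "\<And>i. 0 \<le> w i" "w sums 1"
    and sums: "L2_sums (\<lambda>i x. w i * \<phi> i x) h"
    and E: "\<And>i. E \<le> (L2norm (\<lambda>x. r x + l * \<phi> i x))\<^sup>2"
  shows "E \<le> (L2norm (\<lambda>x. r x + l * h x))\<^sup>2 + l\<^sup>2 * K\<^sup>2"
proof -
  have "(\<lambda>i. L2inner r (\<lambda>x. w i * \<phi> i x)) sums L2inner r h"
    using r h \<phi> sums by (intro L2_sums_L2inner) (auto intro: L2_cmult)
  then have inner: "(\<lambda>i. w i * L2inner r (\<phi> i)) sums L2inner r h"
    by (simp add: L2inner_cmult_right)
  have le: "w i * E \<le> w i * ((L2norm r)\<^sup>2 + l\<^sup>2 * K\<^sup>2) + 2 * l * (w i * L2inner r (\<phi> i))" for i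
  proof -
    have "E \<le> (L2norm r)\<^sup>2 + 2 * l * L2inner r (\<phi> i) + l\<^sup>2 * (L2norm (\<phi> i))\<^sup>2"
      using E[of i] by (simp add: L2norm_sq_add_cmult r \<phi>)
    also have "l\<^sup>2 * (L2norm (\<phi> i))\<^sup>2 \<le> l\<^sup>2 * K\<^sup>2"
      using \<phi>(2)[of i] by (intro mult_left_mono power_mono) (auto simp: L2norm_nonneg)
    finally have "w i * E \<le> w i * ((L2norm r)\<^sup>2 + 2 * l * L2inner r (\<phi> i) + l\<^sup>2 * K\<^sup>2)"
      using w(1)[of i] by (simp add: mult_left_mono)
    then show ?thesis by (simp add: algebra_simps)
  qed
  have "1 * E \<le> 1 * ((L2norm r)\<^sup>2 + l\<^sup>2 * K\<^sup>2) + 2 * l * L2inner r h"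
    by (rule sums_le[OF le sums_mult2[OF w(2)] sums_add[OF sums_mult2[OF w(2)] sums_mult[OF inner]]])
  then have "E \<le> (L2norm r)\<^sup>2 + 2 * l * L2inner r h + l\<^sup>2 * K\<^sup>2" by simp
  also have "\<dots> \<le> (L2norm (\<lambda>x. r x + l * h x))\<^sup>2 + l\<^sup>2 * K\<^sup>2"
    by (simp add: L2norm_sq_add_cmult[OF r h])
  finally show ?thesis .
qed

text \<open>
  The mixing parameter \<open>l\<close> is arbitrary here, because the minimizer in the greedy step competes
  against all of \<open>[0, 1]\<close>; later steps use this inequality with three different values of \<open>l\<close>.
\<close>

lemma relaxed_greedy_step_bound:
  assumes f: "f \<in> L2" and u: "u \<in> L2" "L2norm u \<le> \<epsilon>"
    and \<phi>: "\<And>i. \<phi> i \<in> L2" "\<And>i. L2norm (\<phi> i) \<le> K"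
    and w: "\<And>i. 0 \<le> w i" "w sums 1"
    and sums: "L2_sums (\<lambda>i x. w i * \<phi> i x) (\<lambda>x. f x - u x)"
    and g: "g \<in> L2" "g' \<in> L2" and step: "relaxed_greedy_step (range \<phi>) f g g'"
    and l: "0 \<le> l" "l \<le> 1"
  shows "(L2norm (\<lambda>x. g' x - f x))\<^sup>2
    \<le> ((1 - l) * L2norm (\<lambda>x. g x - f x) + l * \<epsilon>)\<^sup>2 + l\<^sup>2 * K\<^sup>2"
proof -
  obtain l0 \<psi> where min: "is_arg_min (\<lambda>(l, \<phi>). (L2norm (\<lambda>x. (1 - l) * g x + l * \<phi> x - f x))\<^sup>2)
      (\<lambda>p. p \<in> {0..1} \<times> range \<phi>) (l0, \<psi>)"
    and g': "AE x in lebesgue. g' x = (1 - l0) * g x + l0 * \<psi> x"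
    using step unfolding relaxed_greedy_step_def by blast
  have "\<psi> \<in> L2"
    using min \<phi>(1) by (auto simp: is_arg_min_def)
  have "L2norm (\<lambda>x. g' x - f x) = L2norm (\<lambda>x. (1 - l0) * g x + l0 * \<psi> x - f x)"
    using f g \<open>\<psi> \<in> L2\<close> g'
    by (intro L2norm_cong_AE) (auto intro!: L2_diff L2_add L2_cmult)
  moreover have "(L2norm (\<lambda>x. (1 - l0) * g x + l0 * \<psi> x - f x))\<^sup>2
      \<le> (L2norm (\<lambda>x. (1 - l) * g x + l * \<phi> i x - f x))\<^sup>2" for i
  proof -
    have "(l, \<phi> i) \<in> {0..1} \<times> range \<phi>" using l by simp
    then show ?thesis
      using min unfolding is_arg_min_def by (fastforce simp: not_less)
  qed
  ultimately have E: "(L2norm (\<lambda>x. g' x - f x))\<^sup>2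
      \<le> (L2norm (\<lambda>x. ((1 - l) * g x - f x) + l * \<phi> i x))\<^sup>2" for i
    by (simp add: algebra_simps)
  have "(L2norm (\<lambda>x. g' x - f x))\<^sup>2
      \<le> (L2norm (\<lambda>x. ((1 - l) * g x - f x) + l * (f x - u x)))\<^sup>2 + l\<^sup>2 * K\<^sup>2"
    using f u g by (intro convex_average_bound[OF _ _ \<phi> w sums E] L2_diff L2_cmult)
  also have "(\<lambda>x. ((1 - l) * g x - f x) + l * (f x - u x))
      = (\<lambda>x. (1 - l) * (g x - f x) + (- l) * u x)"
    by (simp add: algebra_simps)
  also have "(L2norm (\<lambda>x. (1 - l) * (g x - f x) + (- l) * u x))\<^sup>2
      \<le> ((1 - l) * L2norm (\<lambda>x. g x - f x) + l * \<epsilon>)\<^sup>2"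
  proof (rule power_mono)
    have "L2norm (\<lambda>x. (1 - l) * (g x - f x) + (- l) * u x)
        \<le> L2norm (\<lambda>x. (1 - l) * (g x - f x)) + L2norm (\<lambda>x. (- l) * u x)"
      using f g u by (intro L2norm_triangle L2_cmult L2_diff)
    also have "\<dots> = (1 - l) * L2norm (\<lambda>x. g x - f x) + l * L2norm u"
      unfolding L2norm_cmult using l by simp
    also have "l * L2norm u \<le> l * \<epsilon>"
      using u l by (intro mult_left_mono)
    finally show "L2norm (\<lambda>x. (1 - l) * (g x - f x) + (- l) * u x)
        \<le> (1 - l) * L2norm (\<lambda>x. g x - f x) + l * \<epsilon>" by simp
  qed (rule L2norm_nonneg)
  finally show ?thesis by simp
qed

section \<open>The error recursion\<close>

text \<open>
  Here \<open>m\<close> stands for \<open>K/\<alpha>\<close> and \<open>t\<close> for \<open>\<alpha>\<lambda>\<close>. The value \<open>t = q/(q + m\<^sup>2)\<close> minimizes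
  \<open>(1 - t)\<^sup>2q + t\<^sup>2m\<^sup>2\<close>, and the minimum \<open>qm\<^sup>2/(q + m\<^sup>2)\<close> is half the harmonic mean of \<open>q\<close> and \<open>m\<^sup>2\<close>:
  reciprocals add.
\<close>

lemma harmonic_step_bound:
  fixes q m :: real
  assumes "0 < q" "q \<le> m\<^sup>2 / real n" "1 \<le> n"
  defines "t \<equiv> q / (q + m\<^sup>2)"
  shows "(1 - t)\<^sup>2 * q + t\<^sup>2 * m\<^sup>2 \<le> m\<^sup>2 / real (Suc n)"
proof -
  have pos: "0 < q + m\<^sup>2" using assms(1) by (simp add: add_pos_nonneg)
  have t: "1 - t = m\<^sup>2 / (q + m\<^sup>2)"
    using pos by (simp add: t_def field_simps)
  have "(1 - t)\<^sup>2 * q + t\<^sup>2 * m\<^sup>2 = (m\<^sup>2 * q * (q + m\<^sup>2)) / (q + m\<^sup>2)\<^sup>2"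
    unfolding t by (simp add: t_def power_divide add_divide_distrib[symmetric])
      (simp add: algebra_simps power2_eq_square power4_eq_xxxx)
  also have "\<dots> = m\<^sup>2 * (q / (q + m\<^sup>2))"
    using pos by (simp add: power2_eq_square[of "q + m\<^sup>2"])
  also have "\<dots> \<le> m\<^sup>2 * (1 / real (Suc n))"
  proof (rule mult_left_mono)
    have "q * real n \<le> m\<^sup>2"
      using assms(2,3) by (simp add: field_simps)
    then show "q / (q + m\<^sup>2) \<le> 1 / real (Suc n)"
      using pos by (simp add: field_simps)
  qed simp
  finally show ?thesis by simp
qed

lemma relaxed_recursion_bound:
  fixes e :: "nat \<Rightarrow> real"
  assumes e: "\<And>k. 0 \<le> e k" and "0 \<le> \<epsilon>"
    and step: "\<And>k l. 0 \<le> l \<Longrightarrow> l \<le> 1 \<Longrightarrow> (e (Suc k))\<^sup>2 \<le> ((1 - l) * e k + l * \<epsilon>)\<^sup>2 + l\<^sup>2 * K\<^sup>2"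
    and \<alpha>: "0 < \<alpha>" "\<alpha> < 1"
    and "1 \<le> n"
  shows "(e n)\<^sup>2 \<le> max ((K / \<alpha>)\<^sup>2 / real n) (\<epsilon>\<^sup>2 / (1 - \<alpha>)\<^sup>2)"
proof -
  \<comment> \<open>The side condition at \<open>n\<close> is inherited by all earlier indices, as \<open>e\<close> is nonincreasing; this is
    what makes the induction hypothesis applicable.\<close>
  have far: "(e n)\<^sup>2 \<le> (K / \<alpha>)\<^sup>2 / real n" if "1 \<le> n" "\<epsilon> / (1 - \<alpha>) < e n" for n
    using that
  proof (induction n rule: dec_induct)
    case base
    have \<epsilon>: "\<epsilon> < (1 - \<alpha>) * e 1"
      using base \<alpha> by (simp add: field_simps)
    have "(e 1)\<^sup>2 \<le> \<epsilon>\<^sup>2 + K\<^sup>2"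
      using step[of 1 0] by simp
    also have "\<epsilon>\<^sup>2 \<le> ((1 - \<alpha>) * e 1)\<^sup>2"
      using \<epsilon> \<open>0 \<le> \<epsilon>\<close> by (intro power_mono) auto
    finally have "\<alpha> * (2 - \<alpha>) * (e 1)\<^sup>2 \<le> K\<^sup>2"
      by (simp add: algebra_simps power2_eq_square)
    moreover have "\<alpha> * \<alpha> * (e 1)\<^sup>2 \<le> \<alpha> * (2 - \<alpha>) * (e 1)\<^sup>2"
      using \<alpha> by (intro mult_right_mono mult_left_mono) auto
    ultimately have "\<alpha>\<^sup>2 * (e 1)\<^sup>2 \<le> K\<^sup>2"
      by (simp add: power2_eq_square)
    then show ?case
      using \<alpha> by (simp add: power_divide field_simps)
  next
    case (step n)
    note rec = assms(3)
    have "(e (Suc n))\<^sup>2 \<le> (e n)\<^sup>2"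
      using rec[of 0 n] by simp
    then have "e (Suc n) \<le> e n"
      by (rule power2_le_imp_le) (rule e)
    then have gt: "\<epsilon> / (1 - \<alpha>) < e n"
      using step.prems by simp
    then have \<epsilon>: "\<epsilon> < (1 - \<alpha>) * e n"
      using \<alpha> by (simp add: field_simps)
    have "0 \<le> \<epsilon> / (1 - \<alpha>)"
      using \<open>0 \<le> \<epsilon>\<close> \<alpha> by simp
    then have q: "0 < (e n)\<^sup>2"
      using gt by simp
    have IH: "(e n)\<^sup>2 \<le> (K / \<alpha>)\<^sup>2 / real n"
      using step.IH gt .
    define t where "t = (e n)\<^sup>2 / ((e n)\<^sup>2 + (K / \<alpha>)\<^sup>2)"
    define l where "l = t / \<alpha>"
    have pos: "0 < (e n)\<^sup>2 + (K / \<alpha>)\<^sup>2"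
      using q by (simp add: add_pos_nonneg)
    have "0 \<le> l"
      using pos \<alpha> by (simp add: l_def t_def)
    \<comment> \<open>\<open>l \<le> 1\<close> amounts to \<open>\<alpha>(1 - \<alpha>) e\<^sub>n\<^sup>2 \<le> K\<^sup>2\<close>, which the step leading to \<open>n\<close> provides.\<close>
    obtain k where k: "n = Suc k"
      using \<open>1 \<le> n\<close> by (cases n) auto
    have "(e n)\<^sup>2 \<le> \<epsilon>\<^sup>2 + K\<^sup>2"
      using rec[of 1 k] k by simp
    also have "\<epsilon>\<^sup>2 \<le> ((1 - \<alpha>) * e n)\<^sup>2"
      using \<epsilon> \<open>0 \<le> \<epsilon>\<close> by (intro power_mono) auto
    finally have "\<alpha> * (2 - \<alpha>) * (e n)\<^sup>2 \<le> K\<^sup>2"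
      by (simp add: algebra_simps power2_eq_square)
    moreover have "\<alpha> * (1 - \<alpha>) * (e n)\<^sup>2 \<le> \<alpha> * (2 - \<alpha>) * (e n)\<^sup>2"
      using \<alpha> by (intro mult_right_mono mult_left_mono) auto
    moreover have "\<alpha> * (\<alpha> * ((e n)\<^sup>2 + (K / \<alpha>)\<^sup>2)) = \<alpha> * \<alpha> * (e n)\<^sup>2 + K\<^sup>2"
      using \<alpha> by (simp add: field_simps power2_eq_square)
    ultimately have "\<alpha> * (e n)\<^sup>2 \<le> \<alpha> * (\<alpha> * ((e n)\<^sup>2 + (K / \<alpha>)\<^sup>2))"
      by (simp add: algebra_simps)
    then have "(e n)\<^sup>2 \<le> \<alpha> * ((e n)\<^sup>2 + (K / \<alpha>)\<^sup>2)"
      using \<alpha> by simp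
    then have "l \<le> 1"
      using pos \<alpha> by (simp add: l_def t_def pos_divide_le_eq mult.commute[of \<alpha>])
    have "(e (Suc n))\<^sup>2 \<le> ((1 - l) * e n + l * \<epsilon>)\<^sup>2 + l\<^sup>2 * K\<^sup>2"
      using rec \<open>0 \<le> l\<close> \<open>l \<le> 1\<close> by blast
    also have "((1 - l) * e n + l * \<epsilon>)\<^sup>2 \<le> ((1 - l) * e n + l * ((1 - \<alpha>) * e n))\<^sup>2"
      using \<epsilon> \<open>0 \<le> \<epsilon>\<close> \<open>0 \<le> l\<close> \<open>l \<le> 1\<close> e[of n]
      by (intro power_mono add_left_mono mult_left_mono add_nonneg_nonneg) auto
    also have "((1 - l) * e n + l * ((1 - \<alpha>) * e n))\<^sup>2 + l\<^sup>2 * K\<^sup>2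
        = (1 - t)\<^sup>2 * (e n)\<^sup>2 + t\<^sup>2 * (K / \<alpha>)\<^sup>2"
    proof -
      have "(1 - l) * e n + l * ((1 - \<alpha>) * e n) = (1 - t) * e n"
        using \<alpha> by (simp add: l_def field_simps)
      then show ?thesis
        by (simp add: power_mult_distrib power_divide l_def)
    qed
    also have "\<dots> \<le> (K / \<alpha>)\<^sup>2 / real (Suc n)"
      unfolding t_def using q IH \<open>1 \<le> n\<close> by (rule harmonic_step_bound)
    finally show ?case by simp
  qed
  show ?thesis
  proof (cases "\<epsilon> / (1 - \<alpha>) < e n")
    case True
    then show ?thesis
      using far[OF \<open>1 \<le> n\<close>] by (simp add: max.coboundedI1)
  next
    case False
    then have "(e n)\<^sup>2 \<le> (\<epsilon> / (1 - \<alpha>))\<^sup>2"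
      using e[of n] by (intro power_mono) auto
    then show ?thesis by (simp add: power_divide max.coboundedI2)
  qed
qed

section \<open>The error bound for Gaussian dictionaries\<close>

theorem theorem1:
  fixes f u :: "real^'d \<Rightarrow> real"
    and a s :: "nat \<Rightarrow> real"
    and B :: "nat \<Rightarrow> real^'d^'d"
    and C :: "nat \<Rightarrow> real^'d"
    and \<phi> F :: "nat \<Rightarrow> real^'d \<Rightarrow> real"
    and K \<epsilon> \<alpha> :: real
    and n :: nat
  assumes "f \<in> L2" and "u \<in> L2"
    and "0 \<le> \<epsilon>" and "L2norm u \<le> \<epsilon>"
    and "\<And>i. sym_pos_def (B i)"
    and "(\<lambda>i. \<bar>a i\<bar>) sums K"
    and "L2_sums (\<lambda>i x. a i * gauss (B i) (C i) x) (\<lambda>x. f x - u x)"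
    and "\<And>i. s i \<in> {1, -1}" and "\<And>i. s i * \<bar>a i\<bar> = a i"
    and "\<And>i. \<phi> i = (\<lambda>x. s i * K * gauss (B i) (C i) x)"
    and "\<And>k. F k \<in> L2"
    and "\<And>k. relaxed_greedy_step (range \<phi>) f (F k) (F (Suc k))"
    and "0 < \<alpha>" and "\<alpha> < 1"
    and "1 \<le> n"
  shows "(L2norm (\<lambda>x. F n x - f x))\<^sup>2
    \<le> max (((K + 1) / \<alpha>)\<^sup>2 / real n) (\<epsilon>\<^sup>2 / (1 - \<alpha>)\<^sup>2)"
proof -
  note asm = assms
  have K: "0 \<le> K"
    using sums_le[OF _ sums_zero asm(6)] by simp
  have K0: "a i = 0" if "K = 0" for i
  proof -
    have "(\<Sum>j. \<bar>a j\<bar>) = 0" "summable (\<lambda>j. \<bar>a j\<bar>)"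
      using asm(6) that by (auto simp: sums_iff)
    then show ?thesis
      using suminf_eq_zero_iff[of "\<lambda>j. \<bar>a j\<bar>"] by simp
  qed
  \<comment> \<open>For \<open>K = 0\<close> the weights \<open>\<bar>a i\<bar> / K\<close> are undefined; all \<open>\<phi> i\<close> vanish then, and a point mass serves.\<close>
  define w where "w i = (if K = 0 then (if i = 0 then 1 else 0) else \<bar>a i\<bar> / K)" for i
  have w_nonneg: "0 \<le> w i" for i
    using K by (simp add: w_def)
  have w_sums: "w sums 1"
  proof (cases "K = 0")
    case True
    then show ?thesis
      using sums_single[of 0 "\<lambda>_. 1::real"] by (simp add: w_def[abs_def])
  next
    case False
    then show ?thesis
      using sums_divide[OF asm(6), of K] by (simp add: w_def[abs_def])
  qed
  have w_\<phi>: "w i * \<phi> i x = a i * gauss (B i) (C i) x" for i x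
  proof (cases "K = 0")
    case True
    then show ?thesis by (simp add: K0 asm(10))
  next
    case False
    then have "w i * \<phi> i x = (s i * \<bar>a i\<bar>) * gauss (B i) (C i) x"
      by (simp add: w_def asm(10))
    then show ?thesis by (simp only: asm(9))
  qed
  have \<phi>_L2: "\<phi> i \<in> L2" for i
    unfolding asm(10) by (intro L2_cmult gauss_normalized asm(5))
  have \<phi>_norm: "L2norm (\<phi> i) \<le> K" for i
    using asm(8)[of i] K
    by (auto simp: asm(10) L2norm_cmult gauss_normalized[OF asm(5)])
  have sums: "L2_sums (\<lambda>i x. w i * \<phi> i x) (\<lambda>x. f x - u x)"
    using asm(7) by (simp add: w_\<phi>)
  have "(L2norm (\<lambda>x. F n x - f x))\<^sup>2 \<le> max ((K / \<alpha>)\<^sup>2 / real n) (\<epsilon>\<^sup>2 / (1 - \<alpha>)\<^sup>2)"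
    by (rule relaxed_recursion_bound[where e = "\<lambda>k. L2norm (\<lambda>x. F k x - f x)", OF L2norm_nonneg asm(3)
          relaxed_greedy_step_bound[OF asm(1,2,4) \<phi>_L2 \<phi>_norm w_nonneg w_sums sums asm(11,11,12)]
          asm(13-15)])
  also have "\<dots> \<le> max (((K + 1) / \<alpha>)\<^sup>2 / real n) (\<epsilon>\<^sup>2 / (1 - \<alpha>)\<^sup>2)"
    using K asm(3,13) by (intro max.mono divide_right_mono power_mono) auto
  finally show ?thesis .
qed

end
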